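(* Let $p$ be a prime, $q$ a positive integer, and $A\in\{-1,1\}^{q\times q}$ a matrix with $\mathrm{rank}(A)>1$ (rank over $\mathbb{R}$). Then there are constants $c_1>0$ and $c_2\in(0,1)$ such that for all positive integers $n$, $$\mathcal{R}^{\mathrm{bool},p}_{A^{\otimes n}}(c_1 n)\;\ge\; q^{2n}\left(\frac12-c_2^{\,n}\right).$$
   Context: $\mathbb{F}_p$ is the field with $p$ elements. For $x\in\mathbb{F}_p$ define $\mathrm{bool}(x)=1$ if $x=1$ in $\mathbb{F}_p$ and $\mathrm{bool}(x)=-1$ otherwise. For $A\in\{-1,1\}^{N\times N}$ and real $r\ge0$, the Boolean rigidity $\mathcal{R}^{\mathrm{bool},p}_{A}(r)$ is the minimum, over all $L\in\mathbb{F}_p^{N\times N}$ with $\mathbb{F}_p$-rank at most $r$, of the number of pairs $(i,j)$ with $A[i,j]\neq\mathrm{bool}(L[i,j])$. The Kronecker power $A^{\otimes n}$ of $A\in\{-1,1\}^{q\times q}$ is the $q^n\times q^n$ matrix with rows and columns indexed by $\{0,\dots,q-1\}^n$ and entries $A^{\otimes n}[x,y]=\prod_{i=1}^n A[x_i,y_i]$. *)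

theory Defs
  imports Complex_Main "Jordan_Normal_Form.DL_Rank" "Berlekamp_Zassenhaus.Finite_Field"
begin

(* The field with p elements is 'p mod_ring, where p = CARD('p) is prime by the class prime_card. *)

definition bool_of :: "'p::prime_card mod_ring \<Rightarrow> real" where
  "bool_of x = (if x = 1 then 1 else -1)"

(* For r >= 0 the zero matrix is admissible, so the infimum, taken over a nonempty set of natural
   numbers, is a minimum. *)
definition bool_rigidity :: "'p::prime_card itself \<Rightarrow> real mat \<Rightarrow> real \<Rightarrow> nat" where
  "bool_rigidity _ A r = (let N = dim_row A in
     Inf {card {(i, j). i < N \<and> j < N \<and> A $$ (i, j) \<noteq> bool_of (L $$ (i, j))} |
          L :: 'p mod_ring mat. L \<in> carrier_mat N N \<and> real (vec_space.rank N L) \<le> r})"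

(* Digit i (counting from 0, least significant first) of x in base q. The number x < q^n stands for
   the tuple of its n digits; see bij_betw_digits. *)
definition digit :: "nat \<Rightarrow> nat \<Rightarrow> nat \<Rightarrow> nat" where
  "digit q x i = x div q ^ i mod q"

definition kronecker_power :: "real mat \<Rightarrow> nat \<Rightarrow> real mat" where
  "kronecker_power A n = (let q = dim_row A in
     mat (q ^ n) (q ^ n) (\<lambda>(x, y). \<Prod>i<n. A $$ (digit q x i, digit q y i)))"

lemma digits_inj:
  assumes "x < q ^ n" "y < q ^ n" "\<And>i. i < n \<Longrightarrow> digit q x i = digit q y i"
  shows "x = y"
  using assms
proof (induction n arbitrary: x y)
  case 0
  then show ?case by simp
next
  case (Suc n)
  have "x div q < q ^ n" "y div q < q ^ n"
    using Suc.prems(1,2) by (simp_all add: less_mult_imp_div_less mult.commute)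
  moreover have "digit q (x div q) i = digit q (y div q) i" if "i < n" for i
    using Suc.prems(3)[of "Suc i"] that by (simp add: digit_def div_mult2_eq)
  ultimately have "x div q = y div q" using Suc.IH by blast
  moreover have "x mod q = y mod q" using Suc.prems(3)[of 0] by (simp add: digit_def)
  ultimately show ?case by (metis div_mult_mod_eq)
qed

lemma bij_betw_digits:
  assumes "q > 0"
  shows "bij_betw (\<lambda>x. map (digit q x) [0..<n]) {..<q ^ n} {xs. set xs \<subseteq> {..<q} \<and> length xs = n}"
    (is "bij_betw ?f ?A ?B")
proof -
  have inj: "inj_on ?f ?A"
    by (rule inj_onI) (rule digits_inj[of _ q n], auto)
  have sub: "?f ` ?A \<subseteq> ?B" using assms by (auto simp: digit_def)
  have "card ?B = q ^ n" using card_lists_length_eq[of "{..<q}" n] by simp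
  moreover have "card (?f ` ?A) = q ^ n" using card_image[OF inj] by simp
  moreover have "finite ?B" by (rule finite_lists_length_eq) simp
  ultimately have "?f ` ?A = ?B" using sub by (metis card_subset_eq)
  with inj show ?thesis by (simp add: bij_betw_def)
qed

end

theory Submission
  imports Defs "HOL-Analysis.Convex"
begin

text \<open>
  Over a field with \<open>p\<close> elements, a matrix \<open>L\<close> of rank \<open>r\<close> has at most \<open>p ^ r\<close> distinct columns. Group
  the columns of \<open>L\<close> by value. On each group the Boolean version of \<open>L\<close> is a rank-one sign pattern, so
  its correlation with the \<open>N \<times> N\<close> Kronecker power, \<open>N = q ^ n\<close>, is at most \<open>N\<close> times the operator
  norm of the latter, which is the \<open>n\<close>-th power of the operator norm of \<open>A\<close>. The norm of \<open>A\<close> is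
  strictly below \<open>q\<close>: rank at least two yields two rows that agree in some column and disagree in
  another, and for these two rows Cauchy-Schwarz is not tight. Hence the total correlation is at
  most \<open>p ^ r * N\<^sup>2 * t ^ n\<close> with \<open>t < 1\<close>, and \<open>r = c1 * n\<close> is chosen so
  that \<open>p ^ r\<close> absorbs only the square root of \<open>t ^ n\<close>.
\<close>

section \<open>Operator norms of sign matrices\<close>

lemma sum_signs_squared_le:
  fixes u z :: "'a \<Rightarrow> real"
  assumes "\<And>i. i \<in> S \<Longrightarrow> u i \<in> {-1, 1}"
  shows "(\<Sum>i\<in>S. u i * z i)\<^sup>2 \<le> real (card S) * (\<Sum>i\<in>S. (z i)\<^sup>2)"
proof -
  have "(\<Sum>i\<in>S. (u i)\<^sup>2) = (\<Sum>i\<in>S. 1)"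
    by (rule sum.cong) (use assms in fastforce)+
  then show ?thesis
    using Cauchy_Schwarz_ineq_sum[of u z S] by simp
qed

text \<open>Cauchy-Schwarz is applied separately to the columns where the rows agree and those where
  they differ. Neither set is empty, so each has at most \<open>q - 1\<close> elements.\<close>

lemma two_sign_rows_squared_le:
  fixes u v z :: "nat \<Rightarrow> real"
  assumes u: "\<And>i. i < q \<Longrightarrow> u i \<in> {-1, 1}" and v: "\<And>i. i < q \<Longrightarrow> v i \<in> {-1, 1}"
    and j: "j < q" "u j = v j" and k: "k < q" "u k \<noteq> v k"
  shows "(\<Sum>i<q. u i * z i)\<^sup>2 + (\<Sum>i<q. v i * z i)\<^sup>2 \<le> 2 * (real q - 1) * (\<Sum>i<q. (z i)\<^sup>2)"
proof -
  define E where "E = {i. i < q \<and> u i = v i}"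
  define D where "D = {i. i < q \<and> u i \<noteq> v i}"
  have fin: "finite E" "finite D" and disj: "E \<inter> D = {}" and un: "{..<q} = E \<union> D"
    by (auto simp: E_def D_def)
  have E_subset: "E \<subseteq> {..<q}" and D_subset: "D \<subseteq> {..<q}" using un by auto
  have split: "(\<Sum>i<q. f i) = (\<Sum>i\<in>E. f i) + (\<Sum>i\<in>D. f i)" for f :: "nat \<Rightarrow> real"
    unfolding un by (rule sum.union_disjoint[OF fin disj])
  have "card E + card D = q"
    using card_Un_disjoint[OF fin disj] un by (metis card_lessThan)
  moreover have "card E > 0" "card D > 0"
    using j k fin by (auto simp: card_gt_0_iff E_def D_def)
  ultimately have card: "real (card E) \<le> real q - 1" "real (card D) \<le> real q - 1"
    by linarith+
  \<comment> \<open>\<open>u\<close> and \<open>v\<close> agree on \<open>E\<close> and are opposite on \<open>D\<close>, so the cross terms cancel\<close>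
  let ?e = "\<Sum>i\<in>E. u i * z i" and ?d = "\<Sum>i\<in>D. u i * z i"
  have "(\<Sum>i\<in>E. v i * z i) = ?e"
    by (rule sum.cong) (auto simp: E_def)
  moreover have "(\<Sum>i\<in>D. v i * z i) = - ?d"
    unfolding sum_negf[symmetric] by (rule sum.cong) (use u v in \<open>fastforce simp: D_def\<close>)+
  ultimately have squares: "(\<Sum>i<q. u i * z i)\<^sup>2 + (\<Sum>i<q. v i * z i)\<^sup>2 = 2 * ?e\<^sup>2 + 2 * ?d\<^sup>2"
    by (simp add: split power2_eq_square algebra_simps)
  have part: "(\<Sum>i\<in>S. u i * z i)\<^sup>2 \<le> (real q - 1) * (\<Sum>i\<in>S. (z i)\<^sup>2)"
    if "S \<subseteq> {..<q}" "real (card S) \<le> real q - 1" for S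
  proof -
    have "(\<Sum>i\<in>S. u i * z i)\<^sup>2 \<le> real (card S) * (\<Sum>i\<in>S. (z i)\<^sup>2)"
      using u that(1) by (intro sum_signs_squared_le) blast
    also have "\<dots> \<le> (real q - 1) * (\<Sum>i\<in>S. (z i)\<^sup>2)"
      using that(2) by (intro mult_right_mono sum_nonneg) auto
    finally show ?thesis .
  qed
  show ?thesis
    using squares part[of E] part[of D] card by (simp add: split E_subset D_subset algebra_simps)
qed

text \<open>Rows other than \<open>a\<close> and \<open>b\<close> cost the trivial \<open>q\<close>
  each, these two only \<open>2 * (q - 1)\<close> together, and
  \<open>q * (q - 2) + 2 * (q - 1) = q\<^sup>2 - 2\<close>.\<close>

lemma sign_matrix_operator_norm_le:
  fixes M :: "nat \<Rightarrow> nat \<Rightarrow> real"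
  assumes M: "\<And>i j. i < q \<Longrightarrow> j < q \<Longrightarrow> M i j \<in> {-1, 1}"
    and "a < q" "b < q" and j: "j < q" "M a j = M b j" and k: "k < q" "M a k \<noteq> M b k"
  shows "(\<Sum>i<q. (\<Sum>l<q. M i l * z l)\<^sup>2) \<le> ((real q)\<^sup>2 - 2) * (\<Sum>l<q. (z l)\<^sup>2)"
proof -
  let ?Z = "\<Sum>l<q. (z l)\<^sup>2" and ?r = "\<lambda>i. (\<Sum>l<q. M i l * z l)\<^sup>2"
  have ab: "a \<noteq> b" using k by auto
  have "(\<Sum>i<q. ?r i) = (\<Sum>i\<in>{..<q} - {a, b}. ?r i) + (\<Sum>i\<in>{a, b}. ?r i)"
    using \<open>a < q\<close> \<open>b < q\<close> by (intro sum.subset_diff) auto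
  also have "(\<Sum>i\<in>{a, b}. ?r i) = ?r a + ?r b" using ab by simp
  also have "?r a + ?r b \<le> 2 * (real q - 1) * ?Z"
    by (rule two_sign_rows_squared_le[where j = j and k = k]) (use assms in auto)
  also have "(\<Sum>i\<in>{..<q} - {a, b}. ?r i) \<le> (\<Sum>i\<in>{..<q} - {a, b}. real q * ?Z)"
    using sum_signs_squared_le[of "{..<q}" "M i" z for i] M by (intro sum_mono) fastforce
  also have "\<dots> = (real q - 2) * (real q * ?Z)"
  proof -
    have "card ({..<q} - {a, b}) = q - 2"
      using \<open>a < q\<close> \<open>b < q\<close> ab by (subst card_Diff_subset) auto
    moreover have "q \<ge> 2" using \<open>a < q\<close> \<open>b < q\<close> ab by linarith
    ultimately show ?thesis by (simp add: of_nat_diff)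
  qed
  finally show ?thesis by (simp add: power2_eq_square algebra_simps)
qed

section \<open>Operator norms of Kronecker powers\<close>

lemma sum_power_Suc_split:
  fixes f :: "nat \<Rightarrow> 'a::comm_monoid_add"
  assumes "q > 0"
  shows "(\<Sum>x<q ^ Suc n. f x) = (\<Sum>x<q ^ n. \<Sum>a<q. f (a + q * x))"
proof -
  have "(\<Sum>x<q ^ n. \<Sum>a<q. f (a + q * x)) = (\<Sum>(x, a)\<in>{..<q ^ n} \<times> {..<q}. f (a + q * x))"
    by (rule sum.cartesian_product)
  also have "\<dots> = (\<Sum>x<q ^ Suc n. f x)"
  proof (rule sum.reindex_bij_witness[where i = "\<lambda>x. (x div q, x mod q)" and j = "\<lambda>(x, a). a + q * x"])
    fix p assume p: "p \<in> {..<q ^ n} \<times> {..<q}"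
    then obtain x a where [simp]: "p = (x, a)" and "x < q ^ n" "a < q" by auto
    then have "a + q * x < q * (x + 1)" by simp
    also have "\<dots> \<le> q * q ^ n" using \<open>x < q ^ n\<close> by (intro mult_le_mono2) simp
    finally show "(case p of (x, a) \<Rightarrow> a + q * x) \<in> {..<q ^ Suc n}" by simp
  qed (use assms in \<open>auto simp: less_mult_imp_div_less mult.commute\<close>)
  finally show ?thesis by simp
qed

text \<open>Peeling off the least significant digit writes the next power as \<open>M\<close>
  tensored with the previous one. The two factors act one after the other, so the squared norm
  bounds \<open>c\<close> and \<open>c ^ n\<close> multiply.\<close>

lemma tensor_power_operator_norm_le:
  fixes M :: "nat \<Rightarrow> nat \<Rightarrow> real"
  assumes "q > 0" and "c \<ge> 0"
    and M: "\<And>z. (\<Sum>i<q. (\<Sum>l<q. M i l * z l)\<^sup>2) \<le> c * (\<Sum>l<q. (z l)\<^sup>2)"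
  shows "(\<Sum>x<q ^ n. (\<Sum>y<q ^ n. (\<Prod>i<n. M (digit q x i) (digit q y i)) * z y)\<^sup>2)
    \<le> c ^ n * (\<Sum>y<q ^ n. (z y)\<^sup>2)"
proof (induction n arbitrary: z)
  case 0
  then show ?case by simp
next
  case (Suc n)
  define K where "K m x y = (\<Prod>i<m. M (digit q x i) (digit q y i))" for m x y
  have K_Suc: "K (Suc n) (a + q * x) (b + q * y) = M a b * K n x y" if "a < q" "b < q" for a b x y
    using that unfolding K_def prod.lessThan_Suc_shift by (simp add: digit_def div_mult2_eq)
  \<comment> \<open>The \<open>n\<close>-th power acts on the slice of \<open>z\<close> with lowest
    digit \<open>b\<close>; for fixed \<open>x\<close>, it then remains to apply \<open>M\<close> to
    \<open>w x\<close>.\<close>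
  define w where "w x b = (\<Sum>y<q ^ n. K n x y * z (b + q * y))" for x b
  have inner: "(\<Sum>y<q ^ Suc n. K (Suc n) (a + q * x) y * z y) = (\<Sum>b<q. M a b * w x b)"
    if "a < q" for a x
  proof -
    have "(\<Sum>y<q ^ Suc n. K (Suc n) (a + q * x) y * z y)
        = (\<Sum>y<q ^ n. \<Sum>b<q. M a b * K n x y * z (b + q * y))"
      unfolding sum_power_Suc_split[OF \<open>q > 0\<close>] using that by (intro sum.cong) (auto simp: K_Suc)
    also have "\<dots> = (\<Sum>b<q. \<Sum>y<q ^ n. M a b * K n x y * z (b + q * y))"
      by (rule sum.swap)
    finally show ?thesis by (simp add: w_def sum_distrib_left mult.assoc)
  qed
  have "(\<Sum>x<q ^ Suc n. (\<Sum>y<q ^ Suc n. K (Suc n) x y * z y)\<^sup>2)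
      = (\<Sum>x<q ^ n. \<Sum>a<q. (\<Sum>b<q. M a b * w x b)\<^sup>2)"
    unfolding sum_power_Suc_split[OF \<open>q > 0\<close>, of "\<lambda>x. (\<Sum>y<q ^ Suc n. K (Suc n) x y * z y)\<^sup>2"]
    by (intro sum.cong refl) (simp only: inner lessThan_iff)
  also have "\<dots> \<le> (\<Sum>x<q ^ n. c * (\<Sum>b<q. (w x b)\<^sup>2))"
    by (intro sum_mono M)
  also have "\<dots> = c * (\<Sum>b<q. \<Sum>x<q ^ n. (w x b)\<^sup>2)"
    by (subst sum.swap) (simp add: sum_distrib_left)
  also have "\<dots> \<le> c * (\<Sum>b<q. c ^ n * (\<Sum>y<q ^ n. (z (b + q * y))\<^sup>2))"
    unfolding w_def K_def by (intro mult_left_mono sum_mono Suc.IH \<open>c \<ge> 0\<close>)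
  also have "\<dots> = c ^ Suc n * (\<Sum>y<q ^ Suc n. (z y)\<^sup>2)"
    unfolding sum_power_Suc_split[OF \<open>q > 0\<close>] sum_distrib_left[symmetric]
    by (subst (2) sum.swap) simp
  finally show ?case by (simp only: K_def)
qed

section \<open>Correlation and disagreement of sign matrices\<close>

text \<open>Columns are classified by \<open>g\<close>. Each class contributes the bilinear form of
  \<open>M\<close> at a sign vector and a 0/1 indicator, both of Euclidean norm at most
  \<open>sqrt N\<close>, while \<open>sqrt c\<close> bounds the norm of \<open>M\<close>.\<close>

lemma correlation_le:
  fixes M :: "nat \<Rightarrow> nat \<Rightarrow> real" and g :: "nat \<Rightarrow> 'c" and b :: "nat \<Rightarrow> 'c \<Rightarrow> real"
  assumes M: "\<And>z. (\<Sum>i<N. (\<Sum>j<N. M i j * z j)\<^sup>2) \<le> c * (\<Sum>j<N. (z j)\<^sup>2)" and "c \<ge> 0"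
    and b: "\<And>i s. b i s \<in> {-1, 1}"
  shows "(\<Sum>i<N. \<Sum>j<N. M i j * b i (g j)) \<le> real (card (g ` {..<N})) * (real N * sqrt c)"
proof -
  have "(\<Sum>i<N. \<Sum>j<N. M i j * b i (g j))
      = (\<Sum>i<N. \<Sum>s\<in>g ` {..<N}. \<Sum>j\<in>{j \<in> {..<N}. g j = s}. M i j * b i (g j))"
    by (subst sum.group) auto
  also have "\<dots> = (\<Sum>i<N. \<Sum>s\<in>g ` {..<N}. b i s * (\<Sum>j<N. M i j * of_bool (g j = s)))"
    by (intro sum.cong refl)
       (auto simp: sum_distrib_left of_bool_def if_distrib mult.commute sum.inter_filter[symmetric]
         cong: if_cong intro!: sum.cong)
  also have "\<dots> = (\<Sum>s\<in>g ` {..<N}. \<Sum>i<N. b i s * (\<Sum>j<N. M i j * of_bool (g j = s)))"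
    by (rule sum.swap)
  also have "\<dots> \<le> (\<Sum>s\<in>g ` {..<N}. real N * sqrt c)"
  proof (rule sum_mono)
    fix s
    let ?v = "\<lambda>i. \<Sum>j<N. M i j * of_bool (g j = s)"
    have "(\<Sum>i<N. b i s * ?v i)\<^sup>2 \<le> real N * (\<Sum>i<N. (?v i)\<^sup>2)"
      using sum_signs_squared_le[of "{..<N}" "\<lambda>i. b i s" ?v] b by simp
    also have "\<dots> \<le> real N * (c * (\<Sum>j<N. (of_bool (g j = s))\<^sup>2))"
      by (intro mult_left_mono M) simp
    also have "\<dots> \<le> real N * (c * (\<Sum>j<N. 1))"
      using \<open>c \<ge> 0\<close> by (intro mult_left_mono sum_mono) auto
    also have "\<dots> = (real N * sqrt c)\<^sup>2"
      using \<open>c \<ge> 0\<close> by (simp add: power_mult_distrib power2_eq_square)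
    finally show "(\<Sum>i<N. b i s * ?v i) \<le> real N * sqrt c"
      by (rule power2_le_imp_le) (use \<open>c \<ge> 0\<close> in simp)
  qed
  finally show ?thesis by simp
qed

text \<open>For signs, \<open>1 - M i j * B i j\<close> is 2 at a disagreement and 0
  otherwise.\<close>

lemma card_disagreements_sign_matrices:
  fixes M B :: "nat \<Rightarrow> nat \<Rightarrow> real"
  assumes "\<And>i j. i < N \<Longrightarrow> j < N \<Longrightarrow> M i j \<in> {-1, 1}"
    and "\<And>i j. i < N \<Longrightarrow> j < N \<Longrightarrow> B i j \<in> {-1, 1}"
  shows "2 * real (card {(i, j). i < N \<and> j < N \<and> M i j \<noteq> B i j})
    = (real N)\<^sup>2 - (\<Sum>i<N. \<Sum>j<N. M i j * B i j)"
proof -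
  let ?S = "{(i, j). i < N \<and> j < N \<and> M i j \<noteq> B i j}"
  have "?S = {p \<in> {..<N} \<times> {..<N}. case p of (i, j) \<Rightarrow> M i j \<noteq> B i j}" by auto
  then have "2 * real (card ?S)
      = (\<Sum>p\<in>{..<N} \<times> {..<N}. if (case p of (i, j) \<Rightarrow> M i j \<noteq> B i j) then 2 else 0)"
    by (simp add: sum.inter_filter[symmetric])
  also have "\<dots> = (\<Sum>p\<in>{..<N} \<times> {..<N}. 1 - (case p of (i, j) \<Rightarrow> M i j * B i j))"
    by (rule sum.cong) (use assms in fastforce)+
  also have "\<dots> = (real N)\<^sup>2 - (\<Sum>i<N. \<Sum>j<N. M i j * B i j)"
    by (simp add: sum_subtractf sum.cartesian_product power2_eq_square)
  finally show ?thesis .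
qed

section \<open>Rank and columns\<close>

context vec_space
begin

lemma obtain_column_basis:
  assumes A: "A \<in> carrier_mat n nc"
  obtains U where "U \<subseteq> set (cols A)" "lin_indpt U" "card U = rank A" "set (cols A) \<subseteq> span U"
proof -
  have carrier: "set (cols A) \<subseteq> carrier_vec n" using cols_dim A by blast
  let ?P = "\<lambda>T. T \<subseteq> set (cols A) \<and> lin_indpt T"
  obtain U where max: "maximal U ?P"
    using maximal_exists_superset[of "set (cols A)" ?P "{}"] finite_lin_indpt2 by (auto simp: lin_dep_def)
  then have U: "U \<subseteq> set (cols A)" "lin_indpt U" by (auto simp: maximal_def)
  have "s \<in> span U" if s: "s \<in> set (cols A)" for s
  proof (cases "s \<in> U")
    case True
    then show ?thesis using U carrier span_mem by auto
  next
    case False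
    then have "\<not> ?P (U \<union> {s})" using max by (auto simp: maximal_def)
    then show ?thesis
      using lin_dep_iff_in_span[of U s] U s carrier False by auto
  qed
  then show thesis using that[of U] U rank_card_indpt[OF A max] by auto
qed

text \<open>Every column is a combination of \<open>rank A\<close> basis columns, so it is
  determined by that many coefficients.\<close>

lemma card_columns_le:
  assumes A: "A \<in> carrier_mat n nc" and fin: "finite (UNIV :: 'a set)"
  shows "card (set (cols A)) \<le> CARD('a) ^ rank A"
proof -
  obtain U where U: "U \<subseteq> set (cols A)" "card U = rank A" "set (cols A) \<subseteq> span U"
    using obtain_column_basis[OF A] by metis
  have finU: "finite U" using U(1) by (rule finite_subset) simp
  have carrier: "U \<subseteq> carrier_vec n" using U(1) cols_dim[of A] A by auto
  let ?F = "PiE U (\<lambda>_. UNIV :: 'a set)"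
  have "span U \<subseteq> (\<lambda>f. lincomb f U) ` ?F"
  proof
    fix v assume "v \<in> span U"
    then obtain f where "v = lincomb f U"
      using finite_span[OF finU] carrier by auto
    \<comment> \<open>Only the coefficients on \<open>U\<close> matter; fixing the others makes the
      set of coefficient functions finite.\<close>
    also have "\<dots> = lincomb (restrict f U) U"
      using carrier by (intro lincomb_cong) auto
    finally show "v \<in> (\<lambda>f. lincomb f U) ` ?F" 
      by (rule image_eqI[where x = "restrict f U"]) simp
  qed
  with U have "set (cols A) \<subseteq> (\<lambda>f. lincomb f U) ` ?F" by blast
  moreover have "finite ?F" using finU fin by (intro finite_PiE) auto
  ultimately have "card (set (cols A)) \<le> card ?F"
    by (meson card_image_le card_mono finite_imageI order_trans)
  then show ?thesis using finU U by (simp add: card_PiE)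
qed

text \<open>Ensures that the infimum defining the rigidity is over a nonempty set.\<close>

lemma rank_zero_mat: "rank (0\<^sub>m n nc) = 0"
proof -
  obtain U where U: "U \<subseteq> set (cols (0\<^sub>m n nc))" "lin_indpt U" "card U = rank (0\<^sub>m n nc)"
    using obtain_column_basis[OF zero_carrier_mat] by metis
  have "set (cols (0\<^sub>m n nc)) \<subseteq> {0\<^sub>v n}" by (auto simp: cols_def)
  moreover from this have "0\<^sub>v n \<notin> U" using U vs_zero_lin_dep[of U] by auto
  ultimately have "U = {}" using U(1) by blast
  then show ?thesis using U(3) by simp
qed

lemma rank_gt_1_obtain_columns:
  assumes A: "A \<in> carrier_mat n nc" and "rank A > 1"
  obtains j k where "j < nc" "k < nc" "\<And>c. col A j \<noteq> c \<cdot>\<^sub>v col A k"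
proof -
  obtain U where U: "U \<subseteq> set (cols A)" "lin_indpt U" "card U = rank A"
    using obtain_column_basis[OF A] by metis
  have finU: "finite U" using U(1) by (rule finite_subset) simp
  have carrier: "U \<subseteq> carrier_vec n" using U(1) cols_dim[of A] A by auto
  obtain u v where uv: "u \<in> U" "v \<in> U" "u \<noteq> v"
    using U(3) \<open>rank A > 1\<close> by (metis One_nat_def card_le_Suc0_iff_eq finU not_le)
  have "u \<noteq> c \<cdot>\<^sub>v v" for c
  proof
    assume "u = c \<cdot>\<^sub>v v"
    moreover have "v \<in> span (U - {u})" using uv carrier by (intro span_mem) auto
    then have "c \<cdot>\<^sub>v v \<in> span (U - {u})" using carrier by (intro smult_in_span) auto
    ultimately have "u \<in> span (U - {u})" by simp
    then show False using lindep_span[of U] carrier finU U(2) uv(1) by auto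
  qed
  moreover obtain j k where "u = col A j" "v = col A k" "j < nc" "k < nc"
    using uv U(1) A by (metis carrier_matD(2) cols_length cols_nth in_set_conv_nth subsetD)
  ultimately show thesis using that by blast
qed

end

section \<open>Choice of the constants and the rigidity bound\<close>

theorem theorem1p2:
  fixes q :: nat and A :: "real mat"
  assumes "q > 0"
    and "A \<in> carrier_mat q q"
    and "\<And>i j. i < q \<Longrightarrow> j < q \<Longrightarrow> A $$ (i, j) \<in> {-1, 1}"
    and "vec_space.rank q A > 1"
  shows "\<exists>c1 c2 :: real. c1 > 0 \<and> 0 < c2 \<and> c2 < 1 \<and>
    (\<forall>n::nat. n > 0 \<longrightarrow>
      real (bool_rigidity TYPE('p::prime_card) (kronecker_power A n) (c1 * real n))
        \<ge> real q ^ (2 * n) * (1 / 2 - c2 ^ n))"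
proof -
  obtain j k where jk: "j < q" "k < q" and indep: "\<And>c. col A j \<noteq> c \<cdot>\<^sub>v col A k"
    using vec_space.rank_gt_1_obtain_columns[OF assms(2,4)] by metis
  define M where "M i l = A $$ (i, l)" for i l
  have M: "M i l \<in> {-1, 1}" if "i < q" "l < q" for i l
    using assms(3) that by (simp add: M_def)
  have differ: "\<exists>i<q. M i j \<noteq> c * M i k" for c
  proof (rule ccontr)
    assume "\<not> ?thesis"
    then have "col A j = c \<cdot>\<^sub>v col A k"
      using assms(2) jk by (intro eq_vecI) (auto simp: M_def)
    then show False using indep by blast
  qed
  \<comment> \<open>Columns \<open>j\<close> and \<open>k\<close> are opposite in row
    \<open>a\<close> and equal in row \<open>b\<close>. The product of these four signs is -1, so
    rows \<open>a\<close> and \<open>b\<close> agree in exactly one of the two columns.\<close>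
  obtain a b where ab: "a < q" "b < q" "M a j \<noteq> M a k" "M b j \<noteq> - M b k"
    using differ[of 1] differ[of "-1"] by auto
  have "j \<noteq> k" using ab(3) by auto
  then have "q \<ge> 2" using jk by linarith
  define c where "c = (real q)\<^sup>2 - 2"
  have "(real q)\<^sup>2 \<ge> 2\<^sup>2" using \<open>q \<ge> 2\<close> by (intro power_mono) auto
  then have c: "0 < c" "c < (real q)\<^sup>2" by (auto simp: c_def)
  have norm: "(\<Sum>i<q. (\<Sum>l<q. M i l * z l)\<^sup>2) \<le> c * (\<Sum>l<q. (z l)\<^sup>2)" for z
  proof (cases "M a j = M b j")
    case True
    then have "M a k \<noteq> M b k" using ab M[of a j] M[of b j] M[of a k] M[of b k] jk by auto
    then show ?thesis
      unfolding c_def using True ab(1,2) jk M by (intro sign_matrix_operator_norm_le[of q M a b j k])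
  next
    case False
    then have "M a k = M b k" using ab M[of a j] M[of b j] M[of a k] M[of b k] jk by auto
    then show ?thesis
      unfolding c_def using False ab(1,2) jk M by (intro sign_matrix_operator_norm_le[of q M a b k j])
  qed
  \<comment> \<open>The bound \<open>sqrt c\<close> on the norm of \<open>A\<close> relative to the
    trivial bound \<open>q\<close>: the saving per tensor factor.\<close>
  define t where "t = sqrt c / real q"
  have t: "0 < t" "t < 1"
    using c \<open>q > 0\<close> by (auto simp: t_def real_less_lsqrt)
  define p where "p = real CARD('p)"
  have "p > 1" unfolding p_def using prime_card[where 'a = 'p] prime_gt_1_nat by auto
  \<comment> \<open>chosen so that \<open>p powr c1 = 1 / sqrt t\<close>\<close>
  define c1 where "c1 = - ln (sqrt t) / ln p"
  have "c1 > 0" using t \<open>p > 1\<close> by (auto simp: c1_def divide_neg_pos)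
  have p_powr: "p powr (c1 * real n) = 1 / sqrt t ^ n" for n
  proof -
    have "p powr (c1 * real n) = exp (- (real n * ln (sqrt t)))"
      using \<open>p > 1\<close> by (simp add: powr_def c1_def mult.commute)
    also have "\<dots> = 1 / sqrt t ^ n"
      using t by (simp add: exp_minus exp_of_nat_mult divide_inverse)
    finally show ?thesis .
  qed
  have bound: "real q ^ (2 * n) * (1 / 2 - sqrt t ^ n)
      \<le> real (bool_rigidity TYPE('p) (kronecker_power A n) (c1 * real n))" for n
  proof -
    define N where "N = q ^ n"
    define K where "K x y = (\<Prod>i<n. M (digit q x i) (digit q y i))" for x y
    have dim: "dim_row (kronecker_power A n) = N"
      using assms(2) by (simp add: kronecker_power_def N_def Let_def)
    have entry: "kronecker_power A n $$ (x, y) = K x y" if "x < N" "y < N" for x y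
      using assms(2) that by (simp add: kronecker_power_def N_def K_def M_def Let_def)
    have digit: "digit q x i < q" for x i using \<open>q > 0\<close> by (simp add: digit_def)
    have K: "K x y \<in> {-1, 1}" for x y
    proof -
      have "\<bar>K x y\<bar> = 1"
        unfolding K_def abs_prod
        by (rule prod.neutral) (use M[OF digit digit] in \<open>metis abs_minus abs_one insertE singletonD\<close>)
      then show ?thesis by (auto simp: abs_if split: if_splits)
    qed
    have K_norm: "(\<Sum>i<N. (\<Sum>j<N. K i j * z j)\<^sup>2) \<le> c ^ n * (\<Sum>j<N. (z j)\<^sup>2)" for z
      unfolding N_def K_def using \<open>q > 0\<close> c norm by (intro tensor_power_operator_norm_le) auto
    let ?E = "\<lambda>L :: 'p mod_ring mat.
      card {(i, j). i < N \<and> j < N \<and> kronecker_power A n $$ (i, j) \<noteq> bool_of (L $$ (i, j))}"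
    let ?S = "{?E L | L. L \<in> carrier_mat N N \<and> real (vec_space.rank N L) \<le> c1 * real n}"
    \<comment> \<open>A nonempty set of naturals contains its infimum, so some admissible
      \<open>L\<close> attains the rigidity.\<close>
    have "?E (0\<^sub>m N N) \<in> ?S"
      using \<open>c1 > 0\<close> vec_space.rank_zero_mat[where 'a = "'p mod_ring"] by fastforce
    then have "Inf ?S \<in> ?S" by (intro Inf_nat_def1) blast
    then obtain L :: "'p mod_ring mat" where L: "L \<in> carrier_mat N N"
      and rank: "real (vec_space.rank N L) \<le> c1 * real n" and Inf: "Inf ?S = ?E L" by blast
    \<comment> \<open>The Boolean entry depends on \<open>j\<close> only through the vector
      \<open>col L j\<close>, so the classes are the distinct columns of \<open>L\<close>.\<close>
    let ?b = "\<lambda>i (s :: 'p mod_ring vec). bool_of (s $ i)"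
    have E: "?E L = card {(i, j). i < N \<and> j < N \<and> K i j \<noteq> ?b i (col L j)}"
      using L by (intro arg_cong[where f = card]) (auto simp: entry)
    have "2 * real (?E L) = (real N)\<^sup>2 - (\<Sum>i<N. \<Sum>j<N. K i j * ?b i (col L j))"
      unfolding E by (rule card_disagreements_sign_matrices) (use K in \<open>auto simp: bool_of_def\<close>)
    moreover have "(\<Sum>i<N. \<Sum>j<N. K i j * ?b i (col L j))
        \<le> real (card (col L ` {..<N})) * (real N * sqrt (c ^ n))"
      using K_norm c by (intro correlation_le) (auto simp: bool_of_def)
    moreover have "real (card (col L ` {..<N})) \<le> 1 / sqrt t ^ n"
    proof -
      have "card (col L ` {..<N}) \<le> CARD('p) ^ vec_space.rank N L"
        using vec_space.card_columns_le[OF L] L by (simp add: cols_def atLeast0LessThan)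
      then have "real (card (col L ` {..<N})) \<le> p ^ vec_space.rank N L"
        unfolding p_def by (metis of_nat_le_iff of_nat_power)
      also have "\<dots> = p powr real (vec_space.rank N L)"
        using \<open>p > 1\<close> by (simp add: powr_realpow)
      also have "\<dots> \<le> p powr (c1 * real n)"
        using \<open>p > 1\<close> rank by (intro powr_mono) auto
      finally show ?thesis by (simp add: p_powr)
    qed
    then have "real (card (col L ` {..<N})) * (real N * sqrt (c ^ n))
        \<le> 1 / sqrt t ^ n * (real N * sqrt (c ^ n))"
      using c by (intro mult_right_mono) auto
    \<comment> \<open>Since \<open>sqrt (c ^ n) = N * t ^ n\<close>, the number of distinct columns
      cancels one of two factors \<open>sqrt t ^ n\<close>.\<close>
    moreover have "1 / sqrt t ^ n * (real N * sqrt (c ^ n)) = (real N)\<^sup>2 * sqrt t ^ n"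
    proof -
      have "sqrt c = real q * (sqrt t * sqrt t)" using t(1) \<open>q > 0\<close> by (simp, simp add: t_def)
      then have "sqrt (c ^ n) = real N * (sqrt t ^ n * sqrt t ^ n)"
        by (simp only: real_sqrt_power N_def power_mult_distrib of_nat_power)
      then show ?thesis using t by (simp add: power2_eq_square)
    qed
    moreover have "(real N)\<^sup>2 * sqrt t ^ n \<ge> 0" using t by simp
    moreover have "real q ^ (2 * n) = (real N)\<^sup>2"
      by (simp add: N_def power_mult[symmetric] mult.commute)
    \<comment> \<open>The error obtained is really \<open>Q * s / 2\<close>; nonnegativity of
      \<open>Q * s\<close> allows it to be doubled.\<close>
    moreover have "Q * (1 / 2 - s) \<le> e"
      if "2 * e = Q - T" "T \<le> X" "X \<le> Y" "Y = Q * s" "0 \<le> Q * s" for Q s e T X Y :: real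
      using that by (simp add: algebra_simps)
    ultimately have "real q ^ (2 * n) * (1 / 2 - sqrt t ^ n) \<le> real (?E L)"
      by presburger
    then show ?thesis
      by (simp add: bool_rigidity_def dim Let_def Inf)
  qed
  show ?thesis
    using \<open>c1 > 0\<close> t bound by (intro exI[of _ c1] exI[of _ "sqrt t"]) auto
qed

end
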